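(* Let $\mathcal{G}=(\mathcal{V},\mathcal{E})$ be a directed graph with $\mathcal{V}=\{1,\ldots,N\}$ and a self loop at every node, and let $A\in\mathbb{T}^{N\times N}$ be its tropical adjacency matrix. Then the max-consensus protocol $$x_i(k+1)=\max_{j\in\mathcal{N}_i}\{x_j(k)\},\qquad i\in\mathcal{V},\ k\in\mathbb{Z}_{\ge 0},$$ converges for all initial conditions $\mathbf{x}(0)\in\mathbb{R}^N$ if and only if there exists $k\in\mathbb{N}$ such that $A^k=\mathbf{0}$.
   Context: Tropical semiring: on $\mathbb{R}\cup\{-\infty\}$ put $a\oplus b=\max(a,b)$ and $a\otimes b=a+b$ (zero element $-\infty$, multiplicative identity $0$). $\mathbb{T}=\{0,-\infty\}$ is the binary sub-semiring. Matrix products are tropical: $(A\otimes B)_{ij}=\max_l\{a_{il}+b_{lj}\}$, and $A^k=A\otimes\cdots\otimes A$ ($k$ times). An edge $(j,i)\in\mathcal{E}\subset\mathcal{V}\times\mathcal{V}$ is directed from $j$ to $i$ (node $i$ receives information from node $j$), and $\mathcal{N}_i=\{j\in\mathcal{V}:(j,i)\in\mathcal{E}\}$. Self loops: $(i,i)\in\mathcal{E}$ for all $i\in\mathcal{V}$. The tropical adjacency matrix $A$ of $\mathcal{G}$ has $(A)_{i,j}=0$ if $i=j$ or $(j,i)\in\mathcal{E}$, and $(A)_{i,j}=-\infty$ otherwise. $\mathbf{0}$ denotes the $N\times N$ matrix all of whose entries are the real number $0$. The protocol, started at $\mathbf{x}(0)=(x_1(0),\ldots,x_N(0))$, converges if there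 is $n\in\mathbb{N}$ such that for all $k\ge n$ and all $i\in\mathcal{V}$, $x_i(k)=\max_{j\in\mathcal{V}}\{x_j(0)\}$. *)

theory Defs
  imports "HOL-Analysis.Analysis"
begin

text \<open>
  The tropical semiring on \<open>\<real> \<union> {-\<infinity>}\<close>, set up as an instance of the
  semiring type classes so that the library's matrix product \<open>**\<close> is the tropical one.
  Pitfall: the class constants \<open>+\<close>, \<open>*\<close>, \<open>0\<close>, \<open>1\<close> on this type denote tropical addition (max),
  tropical multiplication (real addition), \<open>-\<infinity>\<close> and the real number \<open>0\<close>, respectively.
\<close>

datatype tropical = NegInf | Finite real

instantiation tropical :: linorder
begin

fun less_eq_tropical :: "tropical \<Rightarrow> tropical \<Rightarrow> bool" where
  "NegInf \<le> b \<longleftrightarrow> True"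
| "Finite x \<le> NegInf \<longleftrightarrow> False"
| "Finite x \<le> Finite y \<longleftrightarrow> x \<le> y"

definition less_tropical :: "tropical \<Rightarrow> tropical \<Rightarrow> bool" where
  "a < b \<longleftrightarrow> a \<le> b \<and> \<not> b \<le> (a :: tropical)"

instance
proof
  fix a b c :: tropical
  show "a < b \<longleftrightarrow> a \<le> b \<and> \<not> b \<le> a" by (rule less_tropical_def)
  show "a \<le> a" by (cases a) auto
  show "a \<le> b \<Longrightarrow> b \<le> c \<Longrightarrow> a \<le> c" by (cases a; cases b; cases c) auto
  show "a \<le> b \<Longrightarrow> b \<le> a \<Longrightarrow> a = b" by (cases a; cases b) auto
  show "a \<le> b \<or> b \<le> a" by (cases a; cases b) auto
qed

end

instantiation tropical :: comm_semiring_1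
begin

definition zero_tropical :: tropical where "0 = NegInf"

definition one_tropical :: tropical where "1 = Finite 0"

definition plus_tropical :: "tropical \<Rightarrow> tropical \<Rightarrow> tropical" where "a + b = max a (b :: tropical)"

fun times_tropical :: "tropical \<Rightarrow> tropical \<Rightarrow> tropical" where
  "Finite x * Finite y = Finite (x + y)"
| "NegInf * b = NegInf"
| "a * NegInf = NegInf"

instance
proof
  fix a b c :: tropical
  show "a + b + c = a + (b + c)" by (simp add: plus_tropical_def max.assoc)
  show "a + b = b + a" by (simp add: plus_tropical_def max.commute)
  show "0 + a = a" by (cases a) (auto simp: plus_tropical_def zero_tropical_def max_def)
  show "a * b * c = a * (b * c)" by (cases a; cases b; cases c) auto
  show "a * b = b * a" by (cases a; cases b) auto
  show "1 * a = a" by (cases a) (auto simp: one_tropical_def)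
  show "(a + b) * c = a * c + b * c"
    by (cases a; cases b; cases c) (auto simp: plus_tropical_def max_def)
  show "0 * a = 0" by (cases a) (auto simp: zero_tropical_def)
  show "a * 0 = 0" by (cases a) (auto simp: zero_tropical_def)
  show "(0 :: tropical) \<noteq> 1" by (simp add: zero_tropical_def one_tropical_def)
qed

end

lemma tropical_sum_eq_Max:
  fixes f :: "'a \<Rightarrow> tropical"
  assumes "finite S" "S \<noteq> {}"
  shows "sum f S = Max (f ` S)"
  using assms
proof (induction rule: finite_ne_induct)
  case (singleton x)
  show ?case by simp
next
  case (insert x F)
  then show ?case by (simp add: plus_tropical_def)
qed

lemma tropical_matrix_mult_nth:
  fixes A :: "tropical ^ 'n ^ 'm" and B :: "tropical ^ 'p ^ 'n"
  shows "(A ** B) $ i $ j = (MAX l. A $ i $ l * B $ l $ j)"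
  by (simp add: matrix_matrix_mult_def tropical_sum_eq_Max)

text \<open>
  The operation \<open>^\<close> on the vector type is the componentwise power, hence a separate definition.
\<close>

primrec matpow :: "'a::semiring_1 ^ 'n ^ 'n \<Rightarrow> nat \<Rightarrow> 'a ^ 'n ^ 'n" where
  "matpow A 0 = mat 1"
| "matpow A (Suc k) = matpow A k ** A"

text \<open>
  A directed graph has node set \<open>UNIV :: 'n set\<close>, with \<open>N = CARD('n)\<close> nodes, and edge set
  \<open>E\<close>, where \<open>(j, i) \<in> E\<close> is directed from \<open>j\<close> to \<open>i\<close>.
\<close>

definition in_neighbours :: "('n \<times> 'n) set \<Rightarrow> 'n \<Rightarrow> 'n set" where
  "in_neighbours E i = {j. (j, i) \<in> E}"

definition tropical_adjacency :: "('n::finite \<times> 'n) set \<Rightarrow> tropical ^ 'n ^ 'n" where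
  "tropical_adjacency E = (\<chi> i j. if i = j \<or> (j, i) \<in> E then Finite 0 else NegInf)"

primrec max_consensus :: "('n::finite \<times> 'n) set \<Rightarrow> real ^ 'n \<Rightarrow> nat \<Rightarrow> real ^ 'n" where
  "max_consensus E x0 0 = x0"
| "max_consensus E x0 (Suc k) = (\<chi> i. MAX j\<in>in_neighbours E i. max_consensus E x0 k $ j)"

definition max_consensus_converges :: "('n::finite \<times> 'n) set \<Rightarrow> real ^ 'n \<Rightarrow> bool" where
  "max_consensus_converges E x0 \<longleftrightarrow>
     (\<exists>n. \<forall>k\<ge>n. \<forall>i. max_consensus E x0 k $ i = (MAX j. x0 $ j))"

end

theory Submission
  imports Defs
begin

text \<open>
  Both sides are statements about walks. The entry \<open>(i, j)\<close> of \<open>A\<^sup>k\<close> is \<open>0\<close> exactly if there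
  is a walk of length \<open>k\<close> from \<open>j\<close> to \<open>i\<close>, and \<open>x\<^sub>i(k)\<close> is the maximum of the \<open>x\<^sub>j(0)\<close> over
  these \<open>j\<close>. If \<open>A\<^sup>k\<close> is the zero-valued matrix, then so are all later powers (by the self loops),
  so every node has seen every initial value. Conversely, the initial condition that is \<open>1\<close> at
  \<open>j\<close> and \<open>0\<close> elsewhere reaches consensus only when a walk leads from \<open>j\<close> to every node.
\<close>

lemma Max_tropical_if:
  fixes P :: "'a::finite \<Rightarrow> bool"
  shows "(MAX l. if P l then Finite 0 else NegInf) = (if \<exists>l. P l then Finite 0 else NegInf)"
  by (rule Max_eqI) (auto intro: rev_image_eqI)

lemma matpow_tropical_adjacency_nth:
  assumes "\<forall>i. (i, i) \<in> E"
  shows "matpow (tropical_adjacency E) k $ i $ j = (if (j, i) \<in> E ^^ k then Finite 0 else NegInf)"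
proof (induction k arbitrary: i j)
  case 0
  show ?case
    by (auto simp: mat_def one_tropical_def zero_tropical_def)
next
  case (Suc k)
  have "matpow (tropical_adjacency E) (Suc k) $ i $ j =
      (MAX l. (if (l, i) \<in> E ^^ k then Finite 0 else NegInf) *
        (if l = j \<or> (j, l) \<in> E then Finite 0 else NegInf))"
    by (simp add: tropical_matrix_mult_nth Suc.IH) (simp add: tropical_adjacency_def)
  \<comment> \<open>A tropical product of entries \<open>0\<close> and \<open>-\<infinity>\<close>
    acts as a conjunction; the self loops absorb the diagonal case \<open>l = j\<close>.\<close>
  also have "\<dots> = (MAX l. if (j, l) \<in> E \<and> (l, i) \<in> E ^^ k then Finite 0 else NegInf)"
    using assms by (intro arg_cong[where f = Max] image_cong refl) auto
  \<comment> \<open>Right multiplication by the adjacency matrix adds an edge at the start of a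
    walk, whereas \<open>E ^^ Suc k\<close> adds it at the end; powers of \<open>E\<close> commute
    with \<open>E\<close>.\<close>
  also have "\<dots> = (if (j, i) \<in> E ^^ Suc k then Finite 0 else NegInf)"
    unfolding Max_tropical_if using relpow_commute[of E k] by (simp add: relcomp_unfold set_eq_iff)
  finally show ?case .
qed

lemma relpow_reflexive:
  assumes "\<forall>i. (i, i) \<in> E"
  shows "(i, i) \<in> E ^^ k"
  using assms by (induction k) auto

text \<open>Any walk can be lengthened by waiting at a self loop.\<close>

lemma relpow_reflexive_mono:
  assumes "\<forall>i. (i, i) \<in> E" and "m \<le> k"
  shows "E ^^ m \<subseteq> E ^^ k"
  using assms(2)
proof (induction rule: dec_induct)
  case (step k)
  then show ?case
    using assms(1) by auto
qed simp

lemma max_consensus_nth: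
  assumes "\<forall>i. (i, i) \<in> E"
  shows "max_consensus E x0 k $ i = (MAX j\<in>{j. (j, i) \<in> E ^^ k}. x0 $ j)"
proof (induction k arbitrary: i)
  case 0
  show ?case by simp
next
  case (Suc k)
  let ?W = "\<lambda>k i. {j. (j, i) \<in> E ^^ k}"
  \<comment> \<open>\<open>Max\<close> is unspecified on the empty set; the self loops ensure that
    each maximum is attained.\<close>
  have ne: "?W k i \<noteq> {}" for k i
    using relpow_reflexive[OF assms] by blast
  show ?case
  proof (rule Max_eqI[symmetric])
    fix y assume "y \<in> ($) x0 ` ?W (Suc k) i"
    then obtain j l where j: "y = x0 $ j" "(j, l) \<in> E ^^ k" "(l, i) \<in> E"
      by auto
    have "y \<le> max_consensus E x0 k $ l"
      using j by (auto simp: Suc.IH intro!: Max_ge)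
    also have "\<dots> \<le> max_consensus E x0 (Suc k) $ i"
      using j(3) by (auto simp: in_neighbours_def intro!: Max_ge)
    finally show "y \<le> max_consensus E x0 (Suc k) $ i" .
  next
    have "in_neighbours E i \<noteq> {}"
      using assms by (auto simp: in_neighbours_def)
    then have "max_consensus E x0 (Suc k) $ i \<in> (\<lambda>l. max_consensus E x0 k $ l) ` in_neighbours E i"
      unfolding max_consensus.simps vec_lambda_beta by (intro Max_in) auto
    then obtain l where l: "(l, i) \<in> E" "max_consensus E x0 (Suc k) $ i = max_consensus E x0 k $ l"
      by (auto simp: in_neighbours_def)
    have "max_consensus E x0 k $ l \<in> ($) x0 ` ?W k l"
      unfolding Suc.IH using ne by (intro Max_in) auto
    with l show "max_consensus E x0 (Suc k) $ i \<in> ($) x0 ` ?W (Suc k) i"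
      by auto
  qed simp
qed

theorem theorem4p11:
  fixes E :: "('n::finite \<times> 'n) set"
  assumes self_loops: "\<forall>i. (i, i) \<in> E"
  shows "(\<forall>x0 :: real ^ 'n. max_consensus_converges E x0) \<longleftrightarrow>
         (\<exists>k\<ge>1. matpow (tropical_adjacency E) k = (\<chi> i j. Finite 0))"
proof -
  have pow_iff: "matpow (tropical_adjacency E) k = (\<chi> i j. Finite 0) \<longleftrightarrow> E ^^ k = UNIV" for k
    by (auto simp: vec_eq_iff matpow_tropical_adjacency_nth[OF self_loops] split: if_splits)
  show ?thesis
    unfolding pow_iff
  proof
    assume conv: "\<forall>x0 :: real ^ 'n. max_consensus_converges E x0"
    have "\<exists>n. \<forall>i. (j, i) \<in> E ^^ n" for j
    proof -
      let ?x = "axis j 1 :: real ^ 'n"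
      obtain n where n: "\<forall>i. max_consensus E ?x n $ i = (MAX l. ?x $ l)"
        using conv unfolding max_consensus_converges_def by blast
      have max1: "(MAX l. ?x $ l) = 1"
        by (rule Max_eqI) (auto simp: axis_def intro: rev_image_eqI)
      have "(j, i) \<in> E ^^ n" for i
      proof -
        have "{l. (l, i) \<in> E ^^ n} \<noteq> {}"
          using relpow_reflexive[OF self_loops] by blast
        then have "(MAX l\<in>{l. (l, i) \<in> E ^^ n}. ?x $ l) \<in> ($) ?x ` {l. (l, i) \<in> E ^^ n}"
          by (intro Max_in) auto
        then have "1 \<in> ($) ?x ` {l. (l, i) \<in> E ^^ n}"
          using n max1 by (simp add: max_consensus_nth[OF self_loops])
        \<comment> \<open>Only the coordinate \<open>j\<close> of \<open>?x\<close> has the value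
          \<open>1\<close>, so the attaining node is \<open>j\<close>.\<close>
        then show ?thesis
          by (auto simp: axis_def split: if_splits)
      qed
      then show ?thesis by blast
    qed
    then obtain n where n: "\<And>j i. (j, i) \<in> E ^^ n j"
      by metis
    \<comment> \<open>The length \<open>n j\<close> depends on the source \<open>j\<close>. As there
      are finitely many nodes, a common bound exists; \<open>Suc\<close> makes it positive.\<close>
    define k where "k = Suc (Max (range n))"
    have "n j \<le> k" for j
      unfolding k_def by (intro le_SucI Max_ge) auto
    then have "(j, i) \<in> E ^^ k" for i j
      using n relpow_reflexive_mono[OF self_loops] by blast
    then have "E ^^ k = UNIV"
      by auto
    then show "\<exists>k\<ge>1. E ^^ k = UNIV"
      unfolding k_def by (metis le_add1 plus_1_eq_Suc)
  next
    assume "\<exists>k\<ge>1. E ^^ k = UNIV"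
    then obtain n where "E ^^ n = UNIV"
      by blast
    then have "E ^^ k = UNIV" if "k \<ge> n" for k
      using relpow_reflexive_mono[OF self_loops that] by auto
    \<comment> \<open>From time \<open>n\<close> on, each node's maximum ranges over all
      nodes.\<close>
    then show "\<forall>x0 :: real ^ 'n. max_consensus_converges E x0"
      unfolding max_consensus_converges_def max_consensus_nth[OF self_loops]
      by (intro allI exI[of _ n]) simp
  qed
qed

end
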